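(* Let $N\in\mathbb{N}$, $N\ge2$, $x_0\in\mathbb{X}$ and $\overline{\alpha}\in(0,1]$, and apply the following algorithm, generating a list $\mathcal{S}=(\sigma(n))_{n\in\mathbb{N}_0}$ of update instants and states $x_n$: start with $\sigma(0)=0$ and $x_0$; given $x_n$, compute $u_N(\cdot;x_n)$ and let $m_n$ be the smallest $j\in\{1,\ldots,N-1\}$ such that $$V_N(x_n)\ \ge\ V_N(x_{u_N}(j;x_n))+\overline{\alpha}\sum_{k=0}^{j-1}\ell\big(x_{u_N}(k;x_n),u_N(k;x_n)\big);$$ apply $\mu_N^{\mathcal{S}}(k;x_n):=u_N(k;x_n)$ for $k=0,\ldots,m_n-1$, and set $\sigma(n+1):=\sigma(n)+m_n$, $x_{n+1}:=x_{u_N}(m_n;x_n)$. Assume that for each $n\in\mathbb{N}_0$ such a $j\in\{1,\ldots,N-1\}$ exists. Then the resulting closed loop satisfies $$\overline{\alpha}\,V_\infty(x_0)\ \le\ \overline{\alpha}\,V_\infty^{\mu_N^{\mathcal{S}}}(x_0)\ \le\ V_N(x_0)\ \le\ V_\infty(x_0).$$ If, in addition, there exist $\alpha_1,\alpha_2,\alpha_3\in\mathcal{K}_\infty$ such that $\alpha_1(\|x\|_{x^\star})\le V_N(x)\le\alpha_2(\|x\|_{x^\star})$ and $\ell(x,u)\ge\alpha_3(\|x\|_{x^\star})$ for all $u\in\mathbb{U}$ hold for every $x=x_{\mu_N^{\mathcal{S}}}(n)$, $n\in\mathbb{N}_0$, then the closed loop trajectory $x_{\mu_N^{\mathcal{S}}}(\cdot)$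 behaves like a trajectory of an asymptotically stable system.
   Context: Let $X,U$ be Banach spaces with metrics $d_X,d_U$, let $\mathbb{X}\subset X$, $\mathbb{U}\subset U$ (state and control constraints), and let $f:X\times U\to X$ define the system $x(n+1)=f(x(n),u(n))$, $x(0)=x_0$. For a control sequence $u$, $x_u(\cdot;x_0)$ denotes the resulting trajectory with $x_u(0;x_0)=x_0$. Let $x^\star\in\mathbb{X}$ and $u^\star\in\mathbb{U}$ with $f(x^\star,u^\star)=x^\star$; write $\|x\|_{x^\star}:=d_X(x,x^\star)$. The stage cost $\ell:X\times U\to[0,\infty)$ is continuous, $\ell(x^\star,u^\star)=0$, and $\ell(x,u)>0$ for all $u\in U$ and all $x\ne x^\star$. Viability is assumed: for every $x\in\mathbb{X}$ there is $u_x\in\mathbb{U}$ with $f(x,u_x)\in\mathbb{X}$. Infinite horizon: $J_\infty(x_0,u)=\sum_{n=0}^\infty\ell(x_u(n;x_0),u(n))$ and $V_\infty(x_0)=\inf J_\infty(x_0,u)$ over all $u:\mathbb{N}_0\to\mathbb{U}$ with $x_u(n;x_0)\in\mathbb{X}$ for all $n\in\mathbb{N}$ (values in $[0,\infty]$). Finite horizon: $J_N(x_0,u)=\sum_{k=0}^{N-1}\ell(x_u(k;x_0),u(k))$, and $V_N(x_0)$ is the minimum of $J_N(x_0,u)$ over all $u\in\mathbb{U}^N$ with $x_u(k;x_0)\in\mathbb{X}$ for $k=1,\ldots,N$. Minima are assumed to be attained. $u_N(\cdot;x_0)$ denotes a (chosen) minimizer, and $x_{u_N}(\cdot;x_0)$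 the corresponding open loop trajectory. The closed loop trajectory is $x_{\mu_N^{\mathcal{S}}}(\sigma(n)+k)=x_{u_N}(k;x_n)$ for $k=0,\ldots,m_n-1$, $n\in\mathbb{N}_0$, and its cost is $V_\infty^{\mu_N^{\mathcal{S}}}(x_0)=\sum_{n=0}^\infty\sum_{k=0}^{m_n-1}\ell(x_{u_N}(k;x_n),\mu_N^{\mathcal{S}}(k;x_n))$. $\mathcal{K}_\infty$: continuous, strictly increasing, unbounded functions $\gamma:[0,\infty)\to[0,\infty)$ with $\gamma(0)=0$. $\mathcal{KL}$: continuous $\beta:[0,\infty)^2\to[0,\infty)$ with $\beta(\cdot,t)\in\mathcal{K}_\infty$ for each $t\ge0$ and, for each $r>0$, $\beta(r,\cdot)$ strictly decreasing with $\lim_{t\to\infty}\beta(r,t)=0$. A trajectory $x(\cdot)$ with $x(0)=x_0$ "behaves like a trajectory of an asymptotically stable system" if there is $\beta\in\mathcal{KL}$ with $x(n)\in\mathbb{X}$ and $\|x(n)\|_{x^\star}\le\beta(\|x_0\|_{x^\star},n)$ for all $n\in\mathbb{N}_0$. *)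

theory Defs
  imports "HOL-Analysis.Analysis"
begin

section \<open>Trajectories and optimal control problems\<close>

primrec traj :: "('x \<Rightarrow> 'u \<Rightarrow> 'x) \<Rightarrow> (nat \<Rightarrow> 'u) \<Rightarrow> 'x \<Rightarrow> nat \<Rightarrow> 'x" where
  "traj f u x0 0 = x0"
| "traj f u x0 (Suc n) = f (traj f u x0 n) (u n)"

definition admissible_inf ::
    "('x \<Rightarrow> 'u \<Rightarrow> 'x) \<Rightarrow> 'x set \<Rightarrow> 'u set \<Rightarrow> 'x \<Rightarrow> (nat \<Rightarrow> 'u) set" where
  "admissible_inf f XX UU x0 =
     {u. (\<forall>n. u n \<in> UU) \<and> (\<forall>n\<ge>1. traj f u x0 n \<in> XX)}"

text \<open>An element of \<open>UU\<^sup>N\<close> is represented by any function on the naturals whose values at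
  \<open>0, \<dots>, N - 1\<close> lie in \<open>UU\<close>; neither \<open>J_fin\<close> nor the constraints look at later values.\<close>

definition admissible_fin ::
    "('x \<Rightarrow> 'u \<Rightarrow> 'x) \<Rightarrow> 'x set \<Rightarrow> 'u set \<Rightarrow> nat \<Rightarrow> 'x \<Rightarrow> (nat \<Rightarrow> 'u) set" where
  "admissible_fin f XX UU N x0 =
     {u. (\<forall>k<N. u k \<in> UU) \<and> (\<forall>k\<in>{1..N}. traj f u x0 k \<in> XX)}"

definition J_inf ::
    "('x \<Rightarrow> 'u \<Rightarrow> 'x) \<Rightarrow> ('x \<Rightarrow> 'u \<Rightarrow> real) \<Rightarrow> 'x \<Rightarrow> (nat \<Rightarrow> 'u) \<Rightarrow> ennreal" where
  "J_inf f l x0 u = (\<Sum>n. ennreal (l (traj f u x0 n) (u n)))"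

definition V_inf ::
    "('x \<Rightarrow> 'u \<Rightarrow> 'x) \<Rightarrow> ('x \<Rightarrow> 'u \<Rightarrow> real) \<Rightarrow> 'x set \<Rightarrow> 'u set \<Rightarrow> 'x \<Rightarrow> ennreal" where
  "V_inf f l XX UU x0 = (INF u \<in> admissible_inf f XX UU x0. J_inf f l x0 u)"

definition J_fin ::
    "('x \<Rightarrow> 'u \<Rightarrow> 'x) \<Rightarrow> ('x \<Rightarrow> 'u \<Rightarrow> real) \<Rightarrow> nat \<Rightarrow> 'x \<Rightarrow> (nat \<Rightarrow> 'u) \<Rightarrow> real" where
  "J_fin f l N x0 u = (\<Sum>k<N. l (traj f u x0 k) (u k))"

text \<open>On \<open>XX\<close> the infimum is over a nonempty set (by viability) of reals bounded below by \<open>0\<close>,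
  and it is a minimum whenever a minimizer in the sense of \<open>is_minimizer\<close> exists.\<close>

definition V_fin ::
    "('x \<Rightarrow> 'u \<Rightarrow> 'x) \<Rightarrow> ('x \<Rightarrow> 'u \<Rightarrow> real) \<Rightarrow> 'x set \<Rightarrow> 'u set \<Rightarrow> nat \<Rightarrow> 'x \<Rightarrow> real" where
  "V_fin f l XX UU N x0 = (INF u \<in> admissible_fin f XX UU N x0. J_fin f l N x0 u)"

definition is_minimizer ::
    "('x \<Rightarrow> 'u \<Rightarrow> 'x) \<Rightarrow> ('x \<Rightarrow> 'u \<Rightarrow> real) \<Rightarrow> 'x set \<Rightarrow> 'u set \<Rightarrow> nat \<Rightarrow> 'x \<Rightarrow> (nat \<Rightarrow> 'u) \<Rightarrow> bool"
  where
  "is_minimizer f l XX UU N x0 u \<longleftrightarrow>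
     is_arg_min (J_fin f l N x0) (\<lambda>v. v \<in> admissible_fin f XX UU N x0) u"

text \<open>The metrics \<open>dX\<close>, \<open>dU\<close> are arbitrary metrics on the Banach spaces, not necessarily the
  ones induced by the norms; taking \<open>dist\<close> for both gives the norm-induced case. Continuity of the
  stage cost refers to these metrics.\<close>

locale constrained_control_system =
  fixes dX :: "'x::banach \<Rightarrow> 'x \<Rightarrow> real" and dU :: "'u::banach \<Rightarrow> 'u \<Rightarrow> real"
    and XX :: "'x set" and UU :: "'u set"
    and f :: "'x \<Rightarrow> 'u \<Rightarrow> 'x" and l :: "'x \<Rightarrow> 'u \<Rightarrow> real"
    and xe :: 'x and ue :: 'u
  assumes metric_X: "Metric_space UNIV dX"
    and metric_U: "Metric_space UNIV dU"
    and xe_mem: "xe \<in> XX"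
    and ue_mem: "ue \<in> UU"
    and equilibrium: "f xe ue = xe"
    and cost_nonneg: "0 \<le> l x u"
    and cost_continuous:
      "continuous_map
         (prod_topology (Metric_space.mtopology UNIV dX) (Metric_space.mtopology UNIV dU))
         euclideanreal (\<lambda>(x, u). l x u)"
    and cost_equilibrium: "l xe ue = 0"
    and cost_pos: "x \<noteq> xe \<Longrightarrow> 0 < l x u"
    and viability: "x \<in> XX \<Longrightarrow> \<exists>u\<in>UU. f x u \<in> XX"

section \<open>Relaxed descent along the open loop optimal trajectory\<close>

definition relaxed_descent ::
    "('x \<Rightarrow> 'u \<Rightarrow> 'x) \<Rightarrow> ('x \<Rightarrow> 'u \<Rightarrow> real) \<Rightarrow> 'x set \<Rightarrow> 'u set \<Rightarrow> nat \<Rightarrow> real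
      \<Rightarrow> ('x \<Rightarrow> nat \<Rightarrow> 'u) \<Rightarrow> 'x \<Rightarrow> nat \<Rightarrow> bool" where
  "relaxed_descent f l XX UU N \<alpha> uN x j \<longleftrightarrow>
     V_fin f l XX UU N x \<ge>
       V_fin f l XX UU N (traj f (uN x) x j)
       + \<alpha> * (\<Sum>k<j. l (traj f (uN x) x k) (uN x k))"

section \<open>Comparison functions\<close>

text \<open>Only the values on the nonnegative half-line matter.\<close>

definition class_K_inf :: "(real \<Rightarrow> real) \<Rightarrow> bool" where
  "class_K_inf \<gamma> \<longleftrightarrow>
     (\<forall>r\<ge>0. \<gamma> r \<ge> 0) \<and> continuous_on {0..} \<gamma> \<and> strict_mono_on {0..} \<gamma> \<and>
     \<not> bounded (\<gamma> ` {0..}) \<and> \<gamma> 0 = 0"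

definition class_KL :: "(real \<Rightarrow> real \<Rightarrow> real) \<Rightarrow> bool" where
  "class_KL \<beta> \<longleftrightarrow>
     (\<forall>r\<ge>0. \<forall>t\<ge>0. \<beta> r t \<ge> 0) \<and>
     continuous_on ({0..} \<times> {0..}) (\<lambda>(r, t). \<beta> r t) \<and>
     (\<forall>t\<ge>0. class_K_inf (\<lambda>r. \<beta> r t)) \<and>
     (\<forall>r>0. (\<forall>s\<ge>0. \<forall>t>s. \<beta> r t < \<beta> r s) \<and> (\<beta> r \<longlongrightarrow> 0) at_top)"

definition behaves_asymptotically_stable ::
    "('x \<Rightarrow> 'x \<Rightarrow> real) \<Rightarrow> 'x set \<Rightarrow> 'x \<Rightarrow> (nat \<Rightarrow> 'x) \<Rightarrow> bool" where
  "behaves_asymptotically_stable d XX xe x \<longleftrightarrow>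
     (\<exists>\<beta>. class_KL \<beta> \<and> (\<forall>n. x n \<in> XX \<and> d (x n) xe \<le> \<beta> (d (x 0) xe) (real n)))"

end

theory Submission
  imports Defs
begin

text \<open>
  The performance estimate is a telescoping argument. The control values applied by the algorithm
  can be pasted together to one control sequence \<open>u\<close> that is admissible on the infinite horizon,
  whose trajectory is the closed loop trajectory and whose cost is the closed loop cost
  (\<open>concatenated_control\<close>, \<open>suminf_blocks\<close>). This gives the first inequality. Adding up the relaxed
  descent inequalities for the blocks bounds \<open>\<alpha>\<close> times the cost of the first \<open>n\<close> blocks by
  \<open>V\<^sub>N(x\<^sub>0) - V\<^sub>N(x\<^sub>n) \<le> V\<^sub>N(x\<^sub>0)\<close>, which gives the second one. The third one holds since
  truncating an infinite sum of nonnegative costs can only decrease it (\<open>V_fin_le_V_inf\<close>).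

  For the stability part, the second inequality says in particular that the stage costs along the
  closed loop are summable, so they tend to \<open>0\<close>; as they dominate \<open>\<alpha>\<^sub>3\<close> of the distance to the
  equilibrium, that distance tends to \<open>0\<close>. If the closed loop starts in the equilibrium, the upper
  bound \<open>\<alpha>\<^sub>2\<close> forces \<open>V\<^sub>N(x\<^sub>0) = 0\<close>, hence all stage costs vanish and the closed loop never leaves
  the equilibrium. For a single sequence these two properties are already the existence of a
  \<open>\<K>\<L>\<close> bound (\<open>class_KL_bound\<close>): only one initial distance \<open>r\<close> occurs, so a decreasing continuous
  majorant of the sequence can be extended linearly in \<open>r\<close>. The function \<open>\<beta>\<close> obtained in this way
  depends on the trajectory.
\<close>

section \<open>Sums and trajectories composed of blocks\<close>

lemma sum_lessThan_add:
  fixes c :: "nat \<Rightarrow> 'a::comm_monoid_add"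
  shows "(\<Sum>i<a + b. c i) = (\<Sum>i<a. c i) + (\<Sum>k<b. c (a + k))"
  by (induction b) (simp_all add: add.assoc)

lemma block_starts_strict_mono:
  fixes \<sigma> m :: "nat \<Rightarrow> nat"
  assumes "\<And>n. \<sigma> (Suc n) = \<sigma> n + m n" and "\<And>n. m n > 0"
  shows "strict_mono \<sigma>"
  using assms by (simp add: strict_mono_Suc_iff)

lemma block_decomposition:
  fixes \<sigma> m :: "nat \<Rightarrow> nat"
  assumes \<sigma>0: "\<sigma> 0 = 0" and \<sigma>: "\<And>n. \<sigma> (Suc n) = \<sigma> n + m n" and m: "\<And>n. m n > 0"
  obtains n k where "i = \<sigma> n + k" and "k < m n"
proof -
  have "\<exists>n k. i = \<sigma> n + k \<and> k < m n"
  proof (induction i)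
    case 0
    show ?case using \<sigma>0 m by (metis add_0)
  next
    case (Suc i)
    then obtain n k where nk: "i = \<sigma> n + k" "k < m n" by blast
    show ?case
    proof (cases "Suc k < m n")
      case True
      then show ?thesis using nk by (metis add_Suc_right)
    next
      case False
      then have "Suc i = \<sigma> (Suc n) + 0" using nk \<sigma> by simp
      then show ?thesis using m by blast
    qed
  qed
  then show ?thesis using that by blast
qed

text \<open>The partial sums of the block sums are a subsequence of the partial sums of the series.\<close>

lemma suminf_blocks:
  fixes c :: "nat \<Rightarrow> ennreal" and \<sigma> m :: "nat \<Rightarrow> nat"
  assumes \<sigma>0: "\<sigma> 0 = 0" and \<sigma>: "\<And>n. \<sigma> (Suc n) = \<sigma> n + m n" and m: "\<And>n. m n > 0"
  shows "(\<Sum>n. \<Sum>k<m n. c (\<sigma> n + k)) = (\<Sum>i. c i)"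
proof -
  have partial: "(\<Sum>j<n. \<Sum>k<m j. c (\<sigma> j + k)) = (\<Sum>i<\<sigma> n. c i)" for n
    by (induction n) (simp_all add: \<sigma>0 \<sigma> sum_lessThan_add)
  have "(\<lambda>n. \<Sum>i<n. c i) \<longlonglongrightarrow> (\<Sum>i. c i)"
    by (intro summable_LIMSEQ summableI)
  then have "((\<lambda>n. \<Sum>i<n. c i) \<circ> \<sigma>) \<longlonglongrightarrow> (\<Sum>i. c i)"
    by (rule LIMSEQ_subseq_LIMSEQ) (rule block_starts_strict_mono[of \<sigma> m, OF \<sigma> m])
  then have "(\<lambda>n. \<Sum>k<m n. c (\<sigma> n + k)) sums (\<Sum>i. c i)"
    by (simp add: sums_def partial o_def)
  then show ?thesis by (rule sums_unique[symmetric])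
qed

text \<open>Every time instant lies in exactly one block, so the control can be read off from the block of
  the current time. The trajectory statement includes the end point \<open>k = m n\<close> of a block, which is
  the starting point of the next one; this is what links the blocks.\<close>

lemma concatenated_control:
  fixes f :: "'x \<Rightarrow> 'u \<Rightarrow> 'x" and w :: "nat \<Rightarrow> nat \<Rightarrow> 'u" and xn :: "nat \<Rightarrow> 'x"
    and \<sigma> m :: "nat \<Rightarrow> nat"
  assumes \<sigma>0: "\<sigma> 0 = 0" and \<sigma>: "\<And>n. \<sigma> (Suc n) = \<sigma> n + m n" and m: "\<And>n. m n > 0"
    and xn: "\<And>n. xn (Suc n) = traj f (w n) (xn n) (m n)"
  obtains u where "\<And>n k. k < m n \<Longrightarrow> u (\<sigma> n + k) = w n k"
    and "\<And>n k. k \<le> m n \<Longrightarrow> traj f u (xn 0) (\<sigma> n + k) = traj f (w n) (xn n) k"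
proof -
  define block where "block i = (LEAST n. i < \<sigma> (Suc n))" for i
  define u where "u i = w (block i) (i - \<sigma> (block i))" for i
  have mono: "\<sigma> i \<le> \<sigma> j" if "i \<le> j" for i j
    using block_starts_strict_mono[of \<sigma> m, OF \<sigma> m] that by (simp add: strict_mono_less_eq)
  have block: "block (\<sigma> n + k) = n" if "k < m n" for n k
    unfolding block_def
  proof (rule Least_equality)
    show "\<sigma> n + k < \<sigma> (Suc n)" using that \<sigma> by simp
    show "n \<le> y" if y: "\<sigma> n + k < \<sigma> (Suc y)" for y
    proof (rule ccontr)
      assume "\<not> n \<le> y"
      then have "\<sigma> (Suc y) \<le> \<sigma> n" by (intro mono) simp
      with y show False by simp
    qed
  qed
  have u: "u (\<sigma> n + k) = w n k" if "k < m n" for n k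
    using block[OF that] by (simp add: u_def)
  have within: "traj f u (xn 0) (\<sigma> n + k) = traj f (w n) (xn n) k"
    if "traj f u (xn 0) (\<sigma> n) = xn n" "k \<le> m n" for n k
    using that(2) by (induction k) (simp_all add: that(1) u)
  have start: "traj f u (xn 0) (\<sigma> n) = xn n" for n
  proof (induction n)
    case (Suc n)
    show ?case using within[OF Suc order_refl] by (simp add: \<sigma> xn)
  qed (simp add: \<sigma>0)
  show ?thesis using that[OF u within[OF start]] .
qed

section \<open>Finite horizon and infinite horizon values\<close>

lemma J_fin_nonneg:
  assumes "\<And>x u. 0 \<le> l x u"
  shows "0 \<le> J_fin f l N x u"
  using assms by (simp add: J_fin_def sum_nonneg)

lemma V_fin_le_J_fin:
  assumes "\<And>x u. 0 \<le> l x u" and "u \<in> admissible_fin f XX UU N x"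
  shows "V_fin f l XX UU N x \<le> J_fin f l N x u"
  unfolding V_fin_def using assms
  by (intro cINF_lower bdd_belowI2[where m = 0] J_fin_nonneg)

lemma is_minimizer_admissible:
  assumes "is_minimizer f l XX UU N x u"
  shows "u \<in> admissible_fin f XX UU N x"
  using assms by (simp add: is_minimizer_def is_arg_min_def)

lemma V_fin_nonneg:
  assumes "\<And>x u. 0 \<le> l x u" and "admissible_fin f XX UU N x \<noteq> {}"
  shows "0 \<le> V_fin f l XX UU N x"
  unfolding V_fin_def using assms by (intro cINF_greatest J_fin_nonneg)

lemma V_fin_le_V_inf:
  assumes nonneg: "\<And>x u. 0 \<le> l x u"
  shows "ennreal (V_fin f l XX UU N x) \<le> V_inf f l XX UU x"
  unfolding V_inf_def
proof (rule INF_greatest)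
  fix u assume u: "u \<in> admissible_inf f XX UU x"
  then have "u \<in> admissible_fin f XX UU N x"
    by (auto simp: admissible_inf_def admissible_fin_def)
  then have "ennreal (V_fin f l XX UU N x) \<le> ennreal (J_fin f l N x u)"
    by (intro ennreal_leI V_fin_le_J_fin nonneg)
  also have "\<dots> = (\<Sum>k<N. ennreal (l (traj f u x k) (u k)))"
    by (simp add: J_fin_def sum_ennreal nonneg)
  also have "\<dots> \<le> J_inf f l x u"
    unfolding J_inf_def by (intro sum_le_suminf summableI) auto
  finally show "ennreal (V_fin f l XX UU N x) \<le> J_inf f l x u" .
qed

section \<open>Comparison functions bounding a single sequence\<close>

lemma class_K_inf_eq_0:
  assumes "class_K_inf \<gamma>" and "0 \<le> r" and "\<gamma> r \<le> 0"
  shows "r = 0"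
proof (rule ccontr)
  assume "r \<noteq> 0"
  with assms have "\<gamma> 0 < \<gamma> r"
    unfolding class_K_inf_def by (intro strict_mono_onD[of "{0..}" \<gamma>]) auto
  with assms show False by (simp add: class_K_inf_def)
qed

lemma class_K_inf_tendsto_0:
  fixes a :: "nat \<Rightarrow> real"
  assumes \<gamma>: "class_K_inf \<gamma>" and a: "\<And>i. 0 \<le> a i" and lim: "(\<lambda>i. \<gamma> (a i)) \<longlonglongrightarrow> 0"
  shows "a \<longlonglongrightarrow> 0"
proof (rule order_tendstoI)
  fix e :: real assume "0 < e"
  have mono: "strict_mono_on {0..} \<gamma>" using \<gamma> by (simp add: class_K_inf_def)
  have "0 < \<gamma> e" using class_K_inf_eq_0[OF \<gamma>, of e] \<open>0 < e\<close> by force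
  with lim have "\<forall>\<^sub>F i in sequentially. \<gamma> (a i) < \<gamma> e" by (rule order_tendstoD)
  then show "\<forall>\<^sub>F i in sequentially. a i < e"
    by eventually_elim (use a \<open>0 < e\<close> strict_mono_on_less[OF mono] in auto)
next
  fix e :: real assume "e < 0"
  then show "\<forall>\<^sub>F i in sequentially. e < a i"
    by (intro always_eventually allI) (meson a less_le_trans)
qed

text \<open>The majorant is a supremum of ramps \<open>a i * \<phi> i\<close>, where \<open>\<phi> i\<close> equals \<open>1\<close> up to time \<open>i\<close> and
  falls linearly to \<open>0\<close> on \<open>[i, i + 1]\<close>. It dominates the sequence because \<open>\<phi> i i = 1\<close>, it is
  continuous because any bound of \<open>a\<close> is a common Lipschitz constant of all ramps, and it tends to \<open>0\<close> because
  at time \<open>t\<close> only the terms with \<open>i > t - 1\<close> contribute. The summand \<open>exp (- t)\<close> makes the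
  monotonicity strict and the values positive.\<close>

lemma strictly_decreasing_continuous_majorant:
  fixes a :: "nat \<Rightarrow> real"
  assumes a0: "\<And>i. 0 \<le> a i" and lim: "a \<longlonglongrightarrow> 0"
  obtains g :: "real \<Rightarrow> real" where "continuous_on UNIV g" and "\<And>t. 0 < g t"
    and "\<And>s t. s < t \<Longrightarrow> g t < g s" and "(g \<longlongrightarrow> 0) at_top" and "\<And>i. a i \<le> g (real i)"
proof -
  obtain C where C: "\<And>i. a i \<le> C"
    using convergent_imp_Bseq[OF convergentI[OF lim]] a0 by (auto simp: Bseq_def)
  have C0: "0 \<le> C" using a0 C by (meson order_trans)
  define \<phi> where "\<phi> i t = max 0 (min 1 (1 + real i - t))" for i t
  define h where "h t = (SUP i. a i * \<phi> i t)" for t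
  have \<phi>: "0 \<le> \<phi> i t" "\<phi> i t \<le> 1" for i t by (auto simp: \<phi>_def)
  have le: "a i * \<phi> i t \<le> a i" for i t using mult_left_mono[OF \<phi>(2) a0] by simp
  have bdd: "bdd_above (range (\<lambda>i. a i * \<phi> i t))" for t
    using le C by (intro bdd_aboveI2[where M = C]) (meson order_trans)
  have upper: "a i * \<phi> i t \<le> h t" for i t
    unfolding h_def by (intro cSUP_upper bdd) simp
  have h0: "0 \<le> h t" for t
    using upper[of 0 t] a0 \<phi> by (meson mult_nonneg_nonneg order_trans)
  have h_anti: "h t \<le> h s" if "s \<le> t" for s t
    unfolding h_def using that
    by (intro cSUP_mono bdd bexI) (auto intro!: mult_left_mono a0 simp: \<phi>_def)
  have h_lip: "h s \<le> h t + C * \<bar>s - t\<bar>" for s t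
    unfolding h_def[of s]
  proof (rule cSUP_least)
    fix i
    have "a i * \<phi> i s \<le> a i * (\<phi> i t + \<bar>s - t\<bar>)"
      by (intro mult_left_mono a0) (auto simp: \<phi>_def)
    also have "\<dots> \<le> h t + C * \<bar>s - t\<bar>"
      unfolding distrib_left by (intro add_mono upper mult_right_mono C) simp
    finally show "a i * \<phi> i s \<le> h t + C * \<bar>s - t\<bar>" .
  qed simp
  have "C-lipschitz_on UNIV h"
  proof (rule lipschitz_onI)
    show "dist (h s) (h t) \<le> C * dist s t" for s t
      using h_lip[of s t] h_lip[of t s] by (simp add: dist_real_def abs_le_iff abs_minus_commute)
  qed (rule C0)
  then have h_cont: "continuous_on UNIV h" by (rule lipschitz_on_continuous_on)
  have h_lim: "(h \<longlongrightarrow> 0) at_top"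
  proof (rule order_tendstoI)
    fix e :: real assume "0 < e"
    then have "\<forall>\<^sub>F i in sequentially. a i < e / 2" by (intro order_tendstoD[OF lim]) simp
    then obtain M where M: "\<And>i. i \<ge> M \<Longrightarrow> a i < e / 2" by (auto simp: eventually_sequentially)
    have "h t < e" if t: "t \<ge> real M + 1" for t
    proof -
      have "h t \<le> e / 2"
        unfolding h_def
      proof (rule cSUP_least)
        fix i
        show "a i * \<phi> i t \<le> e / 2"
        proof (cases "i \<ge> M")
          case True
          then show ?thesis using le[of i t] M[of i] by linarith
        next
          case False
          then have "\<phi> i t = 0" using t by (simp add: \<phi>_def)
          then show ?thesis using \<open>0 < e\<close> by simp
        qed
      qed simp
      with \<open>0 < e\<close> show ?thesis by simp
    qed
    then show "\<forall>\<^sub>F t in at_top. h t < e" unfolding eventually_at_top_linorder by blast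
  next
    fix e :: real assume "e < 0"
    then show "\<forall>\<^sub>F t in at_top. e < h t"
      by (intro always_eventually allI) (meson h0 less_le_trans)
  qed
  show ?thesis
  proof (rule that[of "\<lambda>t. exp (- t) + h t"])
    show "continuous_on UNIV (\<lambda>t. exp (- t) + h t)"
      by (intro continuous_intros h_cont)
    show "0 < exp (- t) + h t" for t
      by (intro add_pos_nonneg h0) simp
    show "exp (- t) + h t < exp (- s) + h s" if "s < t" for s t
      using that by (intro add_less_le_mono h_anti) auto
    have "((\<lambda>t::real. exp (- t)) \<longlongrightarrow> 0) at_top"
      by (rule filterlim_compose[OF exp_at_bot filterlim_uminus_at_bot_at_top])
    from tendsto_add[OF this h_lim]
    show "((\<lambda>t. exp (- t) + h t) \<longlongrightarrow> 0) at_top" by simp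
    show "a i \<le> exp (- real i) + h (real i)" for i
      using upper[of i "real i"] by (simp add: \<phi>_def add_increasing)
  qed
qed

lemma class_KL_linear:
  fixes g :: "real \<Rightarrow> real"
  assumes c: "0 < c" and cont: "continuous_on UNIV g" and pos: "\<And>t. 0 < g t"
    and decr: "\<And>s t. s < t \<Longrightarrow> g t < g s" and lim: "(g \<longlongrightarrow> 0) at_top"
  shows "class_KL (\<lambda>r t. c * r * g t)"
proof -
  have K: "class_K_inf (\<lambda>r. c * r * g t)" for t
    unfolding class_K_inf_def
  proof (intro conjI)
    have cg: "0 < c * g t" using c pos by simp
    show "\<forall>r\<ge>0. 0 \<le> c * r * g t" using c pos[of t] by simp
    show "continuous_on {0..} (\<lambda>r. c * r * g t)" by (intro continuous_intros)
    show "strict_mono_on {0..} (\<lambda>r. c * r * g t)"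
      using c pos[of t] by (auto intro!: strict_mono_onI)
    show "\<not> bounded ((\<lambda>r. c * r * g t) ` {0..})"
    proof
      assume "bounded ((\<lambda>r. c * r * g t) ` {0..})"
      then obtain B where B: "\<And>r. 0 \<le> r \<Longrightarrow> \<bar>c * r * g t\<bar> \<le> B" by (auto simp: bounded_iff)
      have "0 \<le> B" using B[of 0] by simp
      then have "\<bar>c * ((B + 1) / (c * g t)) * g t\<bar> \<le> B" using cg by (intro B) simp
      moreover have "c * ((B + 1) / (c * g t)) * g t = B + 1" using c pos[of t] by simp
      ultimately show False by linarith
    qed
  qed simp
  have "((\<lambda>t. c * r * g t) \<longlongrightarrow> 0) at_top" for r
    using tendsto_mult_right_zero[OF lim] .
  moreover have "continuous_on ({0..} \<times> {0..}) (\<lambda>(r, t). c * r * g t)"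
    unfolding case_prod_beta
    by (intro continuous_intros continuous_on_compose2[OF cont]) auto
  moreover have "0 \<le> c * r * g t" if "0 \<le> r" for r t
    using that c pos[of t] by simp
  ultimately show ?thesis
    unfolding class_KL_def using K c decr by simp
qed

text \<open>The factor in front of the majorant is chosen such that it is \<open>1\<close> at \<open>r = a 0\<close>. A \<open>\<K>\<L>\<close>
  function vanishes at \<open>r = 0\<close>, which is why a sequence starting in \<open>0\<close> has to be constant.\<close>

lemma class_KL_bound:
  fixes a :: "nat \<Rightarrow> real"
  assumes a0: "\<And>i. 0 \<le> a i" and lim: "a \<longlonglongrightarrow> 0" and zero: "\<And>i. a 0 = 0 \<Longrightarrow> a i = 0"
  obtains \<beta> where "class_KL \<beta>" and "\<And>i. a i \<le> \<beta> (a 0) (real i)"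
proof -
  obtain g where g: "continuous_on UNIV g" "\<And>t. 0 < g t" "\<And>s t. s < t \<Longrightarrow> g t < g s"
    "(g \<longlongrightarrow> 0) at_top" "\<And>i. a i \<le> g (real i)"
    using strictly_decreasing_continuous_majorant[OF a0 lim] by blast
  define c where "c = (if a 0 = 0 then 1 else 1 / a 0)"
  have "0 < c" using a0[of 0] by (simp add: c_def)
  then have "class_KL (\<lambda>r t. c * r * g t)" using g(1-4) by (rule class_KL_linear)
  moreover have "a i \<le> c * a 0 * g (real i)" for i
    using zero[of i] g(5)[of i] by (simp add: c_def)
  ultimately show ?thesis by (rule that)
qed

section \<open>Performance and stability of the closed loop\<close>

theorem theorem4p6:
  fixes dX :: "'x::banach \<Rightarrow> 'x \<Rightarrow> real" and dU :: "'u::banach \<Rightarrow> 'u \<Rightarrow> real"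
    and XX :: "'x set" and UU :: "'u set"
    and f :: "'x \<Rightarrow> 'u \<Rightarrow> 'x" and l :: "'x \<Rightarrow> 'u \<Rightarrow> real"
    and xe :: 'x and ue :: 'u
    and N :: nat and x0 :: 'x and \<alpha> :: real
    and uN :: "'x \<Rightarrow> nat \<Rightarrow> 'u"
    and \<sigma> m :: "nat \<Rightarrow> nat" and xn :: "nat \<Rightarrow> 'x"
    and \<mu> :: "nat \<Rightarrow> 'x \<Rightarrow> 'u" and xcl :: "nat \<Rightarrow> 'x"
  assumes system: "constrained_control_system dX dU XX UU f l xe ue"
    and N: "N \<ge> 2" and x0: "x0 \<in> XX" and \<alpha>: "0 < \<alpha>" "\<alpha> \<le> 1"
    and minimizer: "\<And>x. x \<in> XX \<Longrightarrow> is_minimizer f l XX UU N x (uN x)"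
    and init: "\<sigma> 0 = 0" "xn 0 = x0"
    and step_exists: "\<And>n. \<exists>j\<in>{1..N - 1}. relaxed_descent f l XX UU N \<alpha> uN (xn n) j"
    and step_length:
      "\<And>n. m n = (LEAST j. j \<in> {1..N - 1} \<and> relaxed_descent f l XX UU N \<alpha> uN (xn n) j)"
    and feedback: "\<And>n k. k < m n \<Longrightarrow> \<mu> k (xn n) = uN (xn n) k"
    and update_instant: "\<And>n. \<sigma> (Suc n) = \<sigma> n + m n"
    and update_state: "\<And>n. xn (Suc n) = traj f (uN (xn n)) (xn n) (m n)"
    and closed_loop: "\<And>n k. k < m n \<Longrightarrow> xcl (\<sigma> n + k) = traj f (uN (xn n)) (xn n) k"
  defines "V_cl \<equiv> (\<Sum>n. \<Sum>k<m n. ennreal (l (traj f (uN (xn n)) (xn n) k) (\<mu> k (xn n))))"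
  shows "ennreal \<alpha> * V_inf f l XX UU x0 \<le> ennreal \<alpha> * V_cl
       \<and> ennreal \<alpha> * V_cl \<le> ennreal (V_fin f l XX UU N x0)
       \<and> ennreal (V_fin f l XX UU N x0) \<le> V_inf f l XX UU x0
       \<and> ((\<exists>\<alpha>1 \<alpha>2 \<alpha>3. class_K_inf \<alpha>1 \<and> class_K_inf \<alpha>2 \<and> class_K_inf \<alpha>3 \<and>
             (\<forall>n. \<alpha>1 (dX (xcl n) xe) \<le> V_fin f l XX UU N (xcl n) \<and>
                  V_fin f l XX UU N (xcl n) \<le> \<alpha>2 (dX (xcl n) xe) \<and>
                  (\<forall>u\<in>UU. \<alpha>3 (dX (xcl n) xe) \<le> l (xcl n) u)))
           \<longrightarrow> behaves_asymptotically_stable dX XX xe xcl)"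
proof -
  interpret constrained_control_system dX dU XX UU f l xe ue by (rule system)
  interpret X: Metric_space UNIV dX by (rule metric_X)
  let ?V = "V_fin f l XX UU N"
  have m_spec: "m n \<in> {1..N - 1} \<and> relaxed_descent f l XX UU N \<alpha> uN (xn n) (m n)" for n
    unfolding step_length[of n] by (rule LeastI_ex) (use step_exists[of n] in blast)
  have m_pos: "m n > 0" and m_less: "m n < N" for n
    using m_spec[of n] N by auto
  have adm: "uN x \<in> admissible_fin f XX UU N x" if "x \<in> XX" for x
    using minimizer[OF that] by (rule is_minimizer_admissible)
  have traj_mem: "traj f (uN x) x k \<in> XX" if "x \<in> XX" "k \<le> N" for x k
    using adm[OF that(1)] that by (cases "k = 0") (auto simp: admissible_fin_def)
  have xn_mem: "xn n \<in> XX" for n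
    by (induction n) (simp_all add: init x0 update_state traj_mem m_less less_imp_le)
  have V_nonneg: "0 \<le> ?V (xn n)" for n
    using adm[OF xn_mem] by (intro V_fin_nonneg cost_nonneg) blast

  \<comment> \<open>\<open>u\<close> inherits the constraints from the minimizers because \<open>m n < N\<close>: no block leaves the
    horizon on which its minimizer is admissible.\<close>
  obtain u where u: "\<And>n k. k < m n \<Longrightarrow> u (\<sigma> n + k) = uN (xn n) k"
    and traj_u: "\<And>n k. k \<le> m n \<Longrightarrow> traj f u (xn 0) (\<sigma> n + k) = traj f (uN (xn n)) (xn n) k"
    using concatenated_control[where \<sigma> = \<sigma> and m = m and xn = xn and f = f
        and w = "\<lambda>n. uN (xn n)", OF init(1) update_instant m_pos update_state] by blast
  have time_cases: "\<exists>n k. i = \<sigma> n + k \<and> k < m n" for i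
    using block_decomposition[of \<sigma> m, OF init(1) update_instant m_pos] by metis
  have xcl_traj: "xcl i = traj f u x0 i" for i
    using time_cases[of i] closed_loop traj_u init(2) by (metis less_imp_le)
  have xcl_mem: "xcl i \<in> XX" for i
    using time_cases[of i] closed_loop traj_mem[OF xn_mem] m_less
    by (metis less_imp_le less_trans)
  have u_mem: "u i \<in> UU" for i
  proof -
    obtain n k where nk: "i = \<sigma> n + k" "k < m n" using time_cases by blast
    then have "k < N" using m_less[of n] by simp
    with nk adm[OF xn_mem[of n]] show ?thesis by (simp add: u admissible_fin_def)
  qed
  have u_adm: "u \<in> admissible_inf f XX UU x0"
    using u_mem xcl_mem by (simp add: admissible_inf_def xcl_traj)

  define c where "c i = l (xcl i) (u i)" for i
  have c_nonneg: "0 \<le> c i" for i by (simp add: c_def cost_nonneg)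
  have block_cost: "(\<Sum>k<m n. l (traj f (uN (xn n)) (xn n) k) (uN (xn n) k))
      = (\<Sum>k<m n. c (\<sigma> n + k))" for n
    by (intro sum.cong) (simp_all add: c_def closed_loop u)
  have "V_cl = (\<Sum>n. \<Sum>k<m n. ennreal (c (\<sigma> n + k)))"
    unfolding V_cl_def by (intro suminf_cong sum.cong) (simp_all add: c_def closed_loop u feedback)
  then have V_cl_c: "V_cl = (\<Sum>i. ennreal (c i))"
    by (simp add: suminf_blocks[of \<sigma> m "\<lambda>i. ennreal (c i)", OF init(1) update_instant m_pos])

  have first: "V_inf f l XX UU x0 \<le> V_cl"
    unfolding V_inf_def
  proof (rule INF_lower2[OF u_adm])
    show "J_inf f l x0 u \<le> V_cl" by (simp add: J_inf_def V_cl_c c_def xcl_traj)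
  qed

  have telescoped: "\<alpha> * (\<Sum>j<n. \<Sum>k<m j. c (\<sigma> j + k)) + ?V (xn n) \<le> ?V x0" for n
  proof (induction n)
    case (Suc n)
    have "?V (xn (Suc n)) + \<alpha> * (\<Sum>k<m n. c (\<sigma> n + k)) \<le> ?V (xn n)"
      using m_spec[of n] by (simp add: relaxed_descent_def update_state block_cost)
    with Suc show ?case by (simp add: distrib_left)
  qed (simp add: init)
  have second: "ennreal \<alpha> * V_cl \<le> ennreal (?V x0)"
  proof -
    have "ennreal \<alpha> * V_cl = (\<Sum>n. ennreal (\<alpha> * (\<Sum>k<m n. c (\<sigma> n + k))))"
      unfolding \<open>V_cl = (\<Sum>n. \<Sum>k<m n. ennreal (c (\<sigma> n + k)))\<close> ennreal_suminf_cmult[symmetric]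
      using \<alpha> by (intro suminf_cong) (simp add: ennreal_mult sum_nonneg c_nonneg sum_ennreal)
    also have "\<dots> \<le> ennreal (?V x0)"
    proof (rule suminf_le_const[OF summableI])
      fix n
      have "(\<Sum>j<n. ennreal (\<alpha> * (\<Sum>k<m j. c (\<sigma> j + k))))
          = ennreal (\<alpha> * (\<Sum>j<n. \<Sum>k<m j. c (\<sigma> j + k)))"
        using \<alpha> by (simp add: sum_ennreal sum_nonneg c_nonneg sum_distrib_left)
      also have "\<dots> \<le> ennreal (?V x0)"
        using telescoped[of n] V_nonneg[of n] by (intro ennreal_leI) linarith
      finally show "(\<Sum>j<n. ennreal (\<alpha> * (\<Sum>k<m j. c (\<sigma> j + k)))) \<le> ennreal (?V x0)" .
    qed
    finally show ?thesis .
  qed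

  have stable: "behaves_asymptotically_stable dX XX xe xcl"
    if K: "class_K_inf \<alpha>2" "class_K_inf \<alpha>3"
      and bounds: "\<And>n. ?V (xcl n) \<le> \<alpha>2 (dX (xcl n) xe)"
        "\<And>n v. v \<in> UU \<Longrightarrow> \<alpha>3 (dX (xcl n) xe) \<le> l (xcl n) v"
    for \<alpha>2 \<alpha>3
  proof -
    define a where "a i = dX (xcl i) xe" for i
    have a_nonneg: "0 \<le> a i" for i by (simp add: a_def)
    have \<alpha>3_nonneg: "0 \<le> \<alpha>3 (a i)" for i using K(2) a_nonneg by (simp add: class_K_inf_def)
    have \<alpha>3_le: "\<alpha>3 (a i) \<le> c i" for i
      unfolding a_def c_def by (intro bounds u_mem)
    have "ennreal \<alpha> * V_cl \<noteq> top" using second by (metis ennreal_neq_top neq_top_trans)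
    then have "V_cl \<noteq> top" using \<alpha> by (auto simp: ennreal_mult_top)
    then have "summable c"
      unfolding V_cl_c by (intro summable_suminf_not_top c_nonneg)
    then have c_lim: "c \<longlonglongrightarrow> 0" by (rule summable_LIMSEQ_zero)
    have "(\<lambda>i. \<alpha>3 (a i)) \<longlonglongrightarrow> 0"
      by (rule tendsto_sandwich[OF _ _ tendsto_const c_lim])
        (intro always_eventually allI \<alpha>3_nonneg \<alpha>3_le)+
    then have lim: "a \<longlonglongrightarrow> 0" by (rule class_K_inf_tendsto_0[OF K(2) a_nonneg])
    have zero: "a i = 0" if "a 0 = 0" for i
    proof -
      have "?V x0 \<le> 0"
        using bounds(1)[of 0] K(1) that by (simp add: a_def class_K_inf_def xcl_traj)
      then have "ennreal \<alpha> * V_cl = 0" using second by (simp add: ennreal_neg)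
      then have "V_cl = 0" using \<alpha> by simp
      then have "ennreal (c i) = 0" unfolding V_cl_c by (simp add: suminf_eq_zero_iff)
      then have "c i \<le> 0" by (simp add: ennreal_eq_0_iff)
      with \<alpha>3_le[of i] have "\<alpha>3 (a i) \<le> 0" by linarith
      with K(2) a_nonneg show ?thesis by (rule class_K_inf_eq_0)
    qed
    obtain \<beta> where "class_KL \<beta>" "\<And>i. a i \<le> \<beta> (a 0) (real i)"
      using class_KL_bound[OF a_nonneg lim zero] by blast
    then show ?thesis
      unfolding behaves_asymptotically_stable_def using xcl_mem by (auto simp: a_def)
  qed

  have third: "ennreal (?V x0) \<le> V_inf f l XX UU x0"
    by (rule V_fin_le_V_inf) (rule cost_nonneg)
  show ?thesis
  proof (intro conjI impI)
    show "ennreal \<alpha> * V_inf f l XX UU x0 \<le> ennreal \<alpha> * V_cl"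
      by (intro mult_left_mono first) simp
  qed (use second third stable in blast)+
qed

end
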